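(* Let $M=(M^{AB})_{A,B=1}^4$ be a symmetric complex $4\times 4$ matrix, let $x_{\alpha\dot\alpha}\in\mathbb{C}$ ($\alpha=1,2$; $\dot\alpha=\dot1,\dot2$), and let $\theta_1^A,\theta_2^A$ ($A=1,\dots,4$) be eight anticommuting Grassmann generators, with $\Lambda$ the Grassmann algebra over $\mathbb{C}$ that they generate. On the patch $U$ with coordinates $(X,Y,Z,\Psi^A)$ consider the curve, parametrized by $Z$, $$X=-x_{1\dot1}-x_{2\dot1}Z,\qquad Y=-x_{1\dot2}-x_{2\dot2}Z,\qquad \Psi^A=-\theta_1^A-\theta_2^A Z+\tfrac16 M^{AB}\epsilon_{BCDE}\,\theta_2^C\theta_2^D\theta_2^E\,Z^2 .$$ Then this curve extends holomorphically over the second patch $U'$ of the deformed super twistor space: when the coordinates $X',Y',\Psi'^A$ given by the deformed transition functions $$Z'=\frac1Z,\quad X'=\frac XZ,\quad Y'=\frac YZ,\quad \Psi'^A=\frac1Z\Psi^A+\frac1{6Z^2}M^{AB}\epsilon_{BCDE}\Psi^C\Psi^D\Psi^E$$ are evaluated along the curve (for $Z\ne 0$) and expressed in terms of $Z'=1/Z$, they have no pole at $Z'=0$; that is, $X',Y',\Psi'^A$ are polynomials in $Z'$ with coefficients in $\Lambda$, for every $A=1,\dots,4$.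
   Context: Repeated indices $A,B,C,\dots$ are summed over $1,\dots,4$, and $\epsilon_{ABCD}$ is the totally antisymmetric symbol with $\epsilon_{1234}=1$. The deformed super twistor space is the complex supermanifold of dimension $3|4$ obtained by gluing two patches $U$ and $U'$, with coordinates $(X,Y,Z\,|\,\Psi^1,\dots,\Psi^4)$ and $(X',Y',Z'\,|\,\Psi'^1,\dots,\Psi'^4)$ (bosonic $|$ fermionic), by the transition functions displayed in the claim on the overlap $Z\neq0$, $Z'\ne 0$. For $M=0$ it is $\mathbb{CP}^{3|4}\setminus\mathbb{CP}^{1|4}$. All computations take place in the commutative-superalgebra sense over the Grassmann algebra $\Lambda$; the odd quantities $\Psi^A$ along the curve are odd elements of $\Lambda[Z]$. *)

theory Defs
  imports
    "HOL-Analysis.Cartesian_Space"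
    "HOL-Combinatorics.Permutations"
    "HOL-Computational_Algebra.Polynomial"
    "HOL-Library.Product_Lexorder"
begin

section \<open>The Grassmann algebra over the complex numbers\<close>

text \<open>
  Given a linearly ordered finite type \<open>'g\<close> of generators, the ordered monomials
  \<open>g\<^sub>1 g\<^sub>2 \<dots> g\<^sub>k\<close> with \<open>g\<^sub>1 < g\<^sub>2 < \<dots> < g\<^sub>k\<close> form a basis of the Grassmann algebra; they are in
  bijection with the subsets of \<open>'g\<close>.  An element is represented by its coefficients.  The choice
  of linear order affects the algebra only up to isomorphism.
\<close>

typedef 'g grassmann = "UNIV :: ('g set \<Rightarrow> complex) set"
  morphisms gcoeff Grassmann ..

setup_lifting type_definition_grassmann

text \<open>
  The sign which reorders the concatenation of the monomials of \<open>S\<close> and \<open>T\<close> (for disjoint \<open>S\<close>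
  and \<open>T\<close>): minus one to the number of inversions.
\<close>

definition koszul_sign :: "'g::{finite,linorder} set \<Rightarrow> 'g set \<Rightarrow> complex" where
  "koszul_sign S T = (-1) ^ card {(s, t). s \<in> S \<and> t \<in> T \<and> t < s}"

lemma koszul_sign_union_left:
  assumes "S \<inter> R = {}"
  shows "koszul_sign (S \<union> R) T = koszul_sign S T * koszul_sign R T"
proof -
  have "{(s, t). s \<in> S \<union> R \<and> t \<in> T \<and> t < s} =
    {(s, t). s \<in> S \<and> t \<in> T \<and> t < s} \<union> {(s, t). s \<in> R \<and> t \<in> T \<and> t < s}"
    by auto
  moreover have "{(s, t). s \<in> S \<and> t \<in> T \<and> t < s} \<inter> {(s, t). s \<in> R \<and> t \<in> T \<and> t < s} = {}"
    using assms by auto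
  ultimately show ?thesis
    by (simp add: koszul_sign_def card_Un_disjoint power_add)
qed

lemma koszul_sign_union_right:
  assumes "S \<inter> R = {}"
  shows "koszul_sign T (S \<union> R) = koszul_sign T S * koszul_sign T R"
proof -
  have "{(s, t). s \<in> T \<and> t \<in> S \<union> R \<and> t < s} =
    {(s, t). s \<in> T \<and> t \<in> S \<and> t < s} \<union> {(s, t). s \<in> T \<and> t \<in> R \<and> t < s}"
    by auto
  moreover have "{(s, t). s \<in> T \<and> t \<in> S \<and> t < s} \<inter> {(s, t). s \<in> T \<and> t \<in> R \<and> t < s} = {}"
    using assms by auto
  ultimately show ?thesis
    by (simp add: koszul_sign_def card_Un_disjoint power_add)
qed

lemma koszul_sign_empty [simp]: "koszul_sign {} T = 1" "koszul_sign T {} = 1"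
  by (simp_all add: koszul_sign_def)

instantiation grassmann :: (type) ab_group_add
begin

lift_definition zero_grassmann :: "'a grassmann" is "\<lambda>_. 0" .
lift_definition plus_grassmann :: "'a grassmann \<Rightarrow> 'a grassmann \<Rightarrow> 'a grassmann"
  is "\<lambda>f g S. f S + g S" .
lift_definition minus_grassmann :: "'a grassmann \<Rightarrow> 'a grassmann \<Rightarrow> 'a grassmann"
  is "\<lambda>f g S. f S - g S" .
lift_definition uminus_grassmann :: "'a grassmann \<Rightarrow> 'a grassmann"
  is "\<lambda>f S. - f S" .

instance
  by standard (transfer; simp add: fun_eq_iff algebra_simps)+

end

instantiation grassmann :: ("{finite,linorder}") ring_1
begin

lift_definition one_grassmann :: "'a grassmann" is "\<lambda>S. if S = {} then 1 else 0" .

lift_definition times_grassmann :: "'a grassmann \<Rightarrow> 'a grassmann \<Rightarrow> 'a grassmann"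
  is "\<lambda>f g U. \<Sum>S\<in>Pow U. koszul_sign S (U - S) * f S * g (U - S)" .

instance
proof
  fix a b c :: "'a grassmann"
  show "a * b * c = a * (b * c)"
  proof (transfer, rule ext)
    fix f g h :: "'a set \<Rightarrow> complex" and U
    have "(\<Sum>T\<in>Pow U. koszul_sign T (U - T) *
              (\<Sum>S\<in>Pow T. koszul_sign S (T - S) * f S * g (T - S)) * h (U - T)) =
          (\<Sum>(T, S)\<in>Sigma (Pow U) Pow. koszul_sign T (U - T) *
              (koszul_sign S (T - S) * f S * g (T - S)) * h (U - T))"
      by (simp add: sum.Sigma sum_distrib_left sum_distrib_right)
    also have "\<dots> =
          (\<Sum>(S, R)\<in>Sigma (Pow U) (\<lambda>S. Pow (U - S)). koszul_sign S (U - S) * f S *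
              (koszul_sign R (U - S - R) * g R * h (U - S - R)))"
    proof (rule sum.reindex_bij_witness[where
          i = "\<lambda>(S, R). (S \<union> R, S)" and j = "\<lambda>(T, S). (S, T - S)"])
      fix x :: "'a set \<times> 'a set"
      assume "x \<in> Sigma (Pow U) Pow"
      then obtain T S where x: "x = (T, S)" "T \<subseteq> U" "S \<subseteq> T" by auto
      define R where "R = T - S"
      define C where "C = U - T"
      have T: "T = S \<union> R" and US: "U - S = R \<union> C" and C: "U - S - R = C"
        and d: "S \<inter> R = {}" "R \<inter> C = {}"
        using x by (auto simp: R_def C_def)
      have 1: "koszul_sign T C = koszul_sign S C * koszul_sign R C"
        unfolding T using d(1) by (rule koszul_sign_union_left)
      have 2: "koszul_sign S (U - S) = koszul_sign S R * koszul_sign S C"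
        unfolding US using d(2) by (rule koszul_sign_union_right)
      have "koszul_sign S (U - S) * f S * (koszul_sign R C * g R * h C) =
            koszul_sign T C * (koszul_sign S R * f S * g R) * h C"
        unfolding 1 2 by (simp add: mult_ac)
      then show "(case case x of (T, S) \<Rightarrow> (S, T - S) of (S, R) \<Rightarrow>
          koszul_sign S (U - S) * f S * (koszul_sign R (U - S - R) * g R * h (U - S - R))) =
        (case x of (T, S) \<Rightarrow> koszul_sign T (U - T) *
              (koszul_sign S (T - S) * f S * g (T - S)) * h (U - T))"
        by (simp add: x(1) C flip: R_def C_def)
    qed auto
    also have "\<dots> = (\<Sum>S\<in>Pow U. koszul_sign S (U - S) * f S *
              (\<Sum>R\<in>Pow (U - S). koszul_sign R (U - S - R) * g R * h (U - S - R)))"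
      by (simp add: sum.Sigma sum_distrib_left)
    finally show "(\<Sum>T\<in>Pow U. koszul_sign T (U - T) *
              (\<Sum>S\<in>Pow T. koszul_sign S (T - S) * f S * g (T - S)) * h (U - T)) =
          (\<Sum>S\<in>Pow U. koszul_sign S (U - S) * f S *
              (\<Sum>R\<in>Pow (U - S). koszul_sign R (U - S - R) * g R * h (U - S - R)))" .
  qed
  show "1 * a = a"
  proof (transfer, rule ext)
    fix f :: "'a set \<Rightarrow> complex" and U
    have "(\<Sum>S\<in>Pow U. koszul_sign S (U - S) * (if S = {} then 1 else 0) * f (U - S)) =
      (\<Sum>S\<in>{{}}. koszul_sign S (U - S) * (if S = {} then 1 else 0) * f (U - S))"
      by (rule sum.mono_neutral_right) auto
    then show "(\<Sum>S\<in>Pow U. koszul_sign S (U - S) * (if S = {} then 1 else 0) * f (U - S)) = f U"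
      by simp
  qed
  show "a * 1 = a"
  proof (transfer, rule ext)
    fix f :: "'a set \<Rightarrow> complex" and U
    have "(\<Sum>S\<in>Pow U. koszul_sign S (U - S) * f S * (if U - S = {} then 1 else 0)) =
      (\<Sum>S\<in>{U}. koszul_sign S (U - S) * f S * (if U - S = {} then 1 else 0))"
      by (rule sum.mono_neutral_right) auto
    then show "(\<Sum>S\<in>Pow U. koszul_sign S (U - S) * f S * (if U - S = {} then 1 else 0)) = f U"
      by simp
  qed
  show "(a + b) * c = a * c + b * c"
    by transfer (simp add: fun_eq_iff algebra_simps sum.distrib)
  show "a * (b + c) = a * b + a * c"
    by transfer (simp add: fun_eq_iff algebra_simps sum.distrib)
  show "(0 :: 'a grassmann) \<noteq> 1"
    by transfer (simp add: fun_eq_iff)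
qed

end

lift_definition gconst :: "complex \<Rightarrow> 'g grassmann" is "\<lambda>c S. if S = {} then c else 0" .

lift_definition generator :: "'g \<Rightarrow> 'g grassmann" is "\<lambda>i S. if S = {i} then 1 else 0" .

lemma gcoeff_gconst_mult: "gcoeff (gconst c * a) U = c * gcoeff a U"
proof transfer
  fix c and f :: "'a set \<Rightarrow> complex" and U
  have "(\<Sum>S\<in>Pow U. koszul_sign S (U - S) * (if S = {} then c else 0) * f (U - S)) =
    (\<Sum>S\<in>{{}}. koszul_sign S (U - S) * (if S = {} then c else 0) * f (U - S))"
    by (rule sum.mono_neutral_right) auto
  then show "(\<Sum>S\<in>Pow U. koszul_sign S (U - S) * (if S = {} then c else 0) * f (U - S)) = c * f U"
    by simp
qed

lemma gcoeff_mult_gconst: "gcoeff (a * gconst c) U = c * gcoeff a U"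
proof transfer
  fix c and f :: "'a set \<Rightarrow> complex" and U
  have "(\<Sum>S\<in>Pow U. koszul_sign S (U - S) * f S * (if U - S = {} then c else 0)) =
    (\<Sum>S\<in>{U}. koszul_sign S (U - S) * f S * (if U - S = {} then c else 0))"
    by (rule sum.mono_neutral_right) auto
  then show "(\<Sum>S\<in>Pow U. koszul_sign S (U - S) * f S * (if U - S = {} then c else 0)) = c * f U"
    by simp
qed

lemma gconst_central: "a * gconst c = gconst c * a"
  by (simp add: gcoeff_gconst_mult gcoeff_mult_gconst fun_eq_iff flip: gcoeff_inject)

lemma gconst_0 [simp]: "gconst 0 = 0" and gconst_1 [simp]: "gconst 1 = 1"
  by (transfer; simp add: fun_eq_iff)+

lemma gconst_add: "gconst (c + d) = gconst c + gconst d"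
  by transfer (simp add: fun_eq_iff)

lemma gconst_minus: "gconst (- c) = - gconst c"
  by transfer (simp add: fun_eq_iff)

lemma gconst_mult: "gconst (c * d) = gconst c * gconst d"
  unfolding gcoeff_inject[symmetric]
  by (rule ext) (simp only: gcoeff_gconst_mult, transfer, simp)

lemma gcoeff_generator_mult:
  "gcoeff (generator i * generator j) U =
    (if i \<noteq> j \<and> U = {i, j} then if i < j then 1 else - 1 else 0)"
proof transfer
  fix i j :: 'a and U
  have "(\<Sum>S\<in>Pow U. koszul_sign S (U - S) * (if S = {i} then 1 else 0) *
        (if U - S = {j} then 1 else 0)) =
    (\<Sum>S\<in>Pow U. if S = {i} then koszul_sign {i} {j} * (if U - {i} = {j} then 1 else 0) else 0)"
    by (rule sum.cong) auto
  also have "\<dots> = (if i \<in> U \<and> U - {i} = {j} then koszul_sign {i} {j} else 0)"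
    by (simp add: sum.delta)
  also have "i \<in> U \<and> U - {i} = {j} \<longleftrightarrow> i \<noteq> j \<and> U = {i, j}"
    by auto
  also have "koszul_sign {i} {j} = (if j < i then - 1 else 1)"
  proof -
    have "{(s, t). s \<in> {i} \<and> t \<in> {j} \<and> t < s} = (if j < i then {(i, j)} else {})"
      by auto
    then show ?thesis
      by (simp add: koszul_sign_def)
  qed
  finally show "(\<Sum>S\<in>Pow U. koszul_sign S (U - S) * (if S = {i} then 1 else 0) *
        (if U - S = {j} then 1 else 0)) =
    (if i \<noteq> j \<and> U = {i, j} then if i < j then 1 else - 1 else 0)"
    by (auto simp: not_less_iff_gr_or_eq)
qed

lemma generator_anticommute: "generator i * generator j = - (generator j * generator i)"
  unfolding gcoeff_inject[symmetric]
  by (rule ext) (auto simp: uminus_grassmann.rep_eq gcoeff_generator_mult insert_commute dest: less_asym)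

lemma generator_square: "generator i * generator i = 0"
  unfolding gcoeff_inject[symmetric]
  by (rule ext) (simp add: zero_grassmann.rep_eq gcoeff_generator_mult)

text \<open>
  The library's polynomial evaluation requires commutative coefficients, so polynomials over the
  Grassmann algebra are evaluated at a complex number here.
\<close>

definition gpoly :: "'g::{finite,linorder} grassmann poly \<Rightarrow> complex \<Rightarrow> 'g grassmann" where
  "gpoly p z = (\<Sum>k\<le>degree p. coeff p k * gconst (z ^ k))"

section \<open>The Levi-Civita symbol\<close>

text \<open>In the type \<open>4\<close> the index \<open>4\<close> is the same element as \<open>0\<close>.\<close>

definition index_map :: "4 \<Rightarrow> 4 \<Rightarrow> 4 \<Rightarrow> 4 \<Rightarrow> 4 \<Rightarrow> 4" where
  "index_map A B C D i = (if i = 1 then A else if i = 2 then B else if i = 3 then C else D)"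

definition levi_civita :: "4 \<Rightarrow> 4 \<Rightarrow> 4 \<Rightarrow> 4 \<Rightarrow> complex" where
  "levi_civita A B C D =
    (if bij (index_map A B C D) then of_int (sign (index_map A B C D)) else 0)"

lemma levi_civita_1234: "levi_civita 1 2 3 4 = 1"
proof -
  have "index_map 1 2 3 4 = id"
    by (rule ext) (use exhaust_4 in \<open>auto simp: index_map_def\<close>)
  then show ?thesis
    by (simp add: levi_civita_def)
qed

lemma sign_comp_transposition:
  fixes p :: "4 \<Rightarrow> 4"
  assumes "bij p" "a \<noteq> b"
  shows "sign (p \<circ> Transposition.transpose a b) = - sign p"
proof -
  have "permutation p"
    using assms(1) bij_imp_permutes[of p UNIV] by (auto simp: permutation_permutes)
  then show ?thesis
    using assms(2) by (simp add: sign_compose permutation_swap_id sign_swap_id)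
qed

lemma levi_civita_comp_transposition:
  assumes "index_map A' B' C' D' = index_map A B C D \<circ> Transposition.transpose a b" "a \<noteq> b"
  shows "levi_civita A' B' C' D' = - levi_civita A B C D"
proof -
  have "bij (index_map A' B' C' D') \<longleftrightarrow> bij (index_map A B C D)"
    unfolding assms(1) using bij_comp[of "Transposition.transpose a b"]
    by (metis bij_swap_comp bij_transpose comp_assoc comp_id transpose_comp_involutory)
  then show ?thesis
    using sign_comp_transposition[of "index_map A B C D" a b] assms
    by (simp add: levi_civita_def)
qed

lemma levi_civita_antisym:
  "levi_civita B A C D = - levi_civita A B C D"
  "levi_civita A C B D = - levi_civita A B C D"
  "levi_civita A B D C = - levi_civita A B C D"
proof -
  show "levi_civita B A C D = - levi_civita A B C D"
    by (rule levi_civita_comp_transposition[of _ _ _ _ _ _ _ _ 1 2])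
      (auto simp: index_map_def Transposition.transpose_def fun_eq_iff)
  show "levi_civita A C B D = - levi_civita A B C D"
    by (rule levi_civita_comp_transposition[of _ _ _ _ _ _ _ _ 2 3])
      (auto simp: index_map_def Transposition.transpose_def fun_eq_iff)
  have "i = 1 \<or> i = 2 \<or> i = 3 \<or> i = 4" for i :: 4
    by (rule exhaust_4)
  then show "levi_civita A B D C = - levi_civita A B C D"
    by (intro levi_civita_comp_transposition[of _ _ _ _ _ _ _ _ 3 4])
      (force simp: index_map_def Transposition.transpose_def fun_eq_iff)+
qed

section \<open>The curve and the deformed super twistor space\<close>

type_synonym Lambda = "(2 \<times> 4) grassmann"

definition theta :: "2 \<Rightarrow> 4 \<Rightarrow> Lambda" where
  "theta \<alpha> A = generator (\<alpha>, A)"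

text \<open>The cubic expression \<open>M\<^sup>A\<^sup>B \<epsilon>\<^sub>B\<^sub>C\<^sub>D\<^sub>E \<xi>\<^sup>C \<xi>\<^sup>D \<xi>\<^sup>E\<close>.\<close>

definition cubic :: "complex^4^4 \<Rightarrow> (4 \<Rightarrow> Lambda) \<Rightarrow> 4 \<Rightarrow> Lambda" where
  "cubic M \<xi> A = (\<Sum>B\<in>UNIV. \<Sum>C\<in>UNIV. \<Sum>D\<in>UNIV. \<Sum>E\<in>UNIV.
     gconst (M $ A $ B * levi_civita B C D E) * \<xi> C * \<xi> D * \<xi> E)"

text \<open>
  Coordinates of a point on either patch, with values in \<open>\<Lambda>\<close>; along the curves considered
  the coordinate \<open>Z\<close> is an ordinary complex number.
\<close>

record coordinates =
  X_coord :: Lambda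
  Y_coord :: Lambda
  Z_coord :: complex
  Psi_coord :: "4 \<Rightarrow> Lambda"

text \<open>The change of coordinates from \<open>U\<close> to \<open>U'\<close>; it is meaningful for \<open>Z \<noteq> 0\<close>.\<close>

definition transition :: "complex^4^4 \<Rightarrow> coordinates \<Rightarrow> coordinates" where
  "transition M P = (let Z = Z_coord P in
    \<lparr> X_coord = gconst (1 / Z) * X_coord P,
      Y_coord = gconst (1 / Z) * Y_coord P,
      Z_coord = 1 / Z,
      Psi_coord = (\<lambda>A. gconst (1 / Z) * Psi_coord P A
                       + gconst (1 / (6 * Z\<^sup>2)) * cubic M (Psi_coord P) A) \<rparr>)"

text \<open>The matrix entry \<open>x $ \<alpha> $ \<beta>\<close> is \<open>x\<close> with undotted index \<open>\<alpha>\<close> and dotted index \<open>\<beta>\<close>.\<close>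

definition curve :: "complex^4^4 \<Rightarrow> complex^2^2 \<Rightarrow> complex \<Rightarrow> coordinates" where
  "curve M x Z =
    \<lparr> X_coord = gconst (- x $ 1 $ 1 - x $ 2 $ 1 * Z),
      Y_coord = gconst (- x $ 1 $ 2 - x $ 2 $ 2 * Z),
      Z_coord = Z,
      Psi_coord = (\<lambda>A. - theta 1 A - theta 2 A * gconst Z
                       + gconst (1 / 6) * cubic M (theta 2) A * gconst (Z\<^sup>2)) \<rparr>"

end

theory Submission
  imports Defs
begin

text \<open>
  Polarize the cubic to a trilinear form \<open>T\<close>, which is symmetric on anticommuting arguments, and
  write the curve as \<open>\<Psi> = - a - b Z + \<kappa> Z\<^sup>2 / 6\<close> with \<open>a = \<theta>\<^sub>1\<close>, \<open>b = \<theta>\<^sub>2\<close>,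
  \<open>\<kappa> = T(b, b, b)\<close>.  The pole of \<open>\<Psi>'\<close> at \<open>Z' = 0\<close> collects the terms with a positive power of
  \<open>Z\<close>.  The linear terms \<open>\<kappa> Z / 6\<close> and \<open>- T(b, b, b) Z / 6\<close> cancel.  All the others contain
  \<open>T(b, \<kappa>, _)\<close> or \<open>T(\<kappa>, \<kappa>, _)\<close>.  The former vanish because \<open>b\<^sup>D \<kappa>\<^sup>E = 6 M\<^sup>E\<^sup>D b\<^sup>1 b\<^sup>2 b\<^sup>3 b\<^sup>4\<close> is
  symmetric in \<open>D\<close> and \<open>E\<close>, like \<open>M\<close>, and is contracted with \<open>\<epsilon>\<close>; the latter because
  \<open>\<kappa>\<^sup>D \<kappa>\<^sup>E\<close> has degree six in the four odd elements \<open>b\<^sup>1, \<dots>, b\<^sup>4\<close>.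
\<close>

section \<open>Scalars, coefficients and polynomial evaluation in the Grassmann algebra\<close>

lemma gconst_left_commute: "a * (gconst c * b) = gconst c * (a * b)"
  by (metis gconst_central mult.assoc)

lemma gconst_sum: "gconst (sum f I) = (\<Sum>i\<in>I. gconst (f i))"
  by (induction I rule: infinite_finite_induct) (simp_all add: gconst_add)

lemma gcoeff_add: "gcoeff (a + b) U = gcoeff a U + gcoeff b U"
  by transfer simp

lemma gcoeff_minus: "gcoeff (- a) U = - gcoeff a U"
  by transfer simp

lemma gcoeff_diff: "gcoeff (a - b) U = gcoeff a U - gcoeff b U"
  by transfer simp

text \<open>Complex coefficients have no 2-torsion; this turns antisymmetry into vanishing.\<close>

lemma grassmann_eq_minus_self_iff: "(a :: 'g grassmann) = - a \<longleftrightarrow> a = 0"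
  by transfer (auto simp: fun_eq_iff)

text \<open>Leading coefficients of an explicit list may vanish, so evaluation needs a bound on the
  degree rather than its exact value.\<close>

lemma gpoly_eq_sum:
  assumes "degree p \<le> n"
  shows "gpoly p z = (\<Sum>k\<le>n. coeff p k * gconst (z ^ k))"
  unfolding gpoly_def using assms
  by (intro sum.mono_neutral_left) (auto simp: coeff_eq_0)

lemma gpoly_linear: "gpoly [:a, b:] z = a + b * gconst z"
  by (subst gpoly_eq_sum[where n = 1]) (auto simp: atMost_Suc)

lemma gpoly_quadratic: "gpoly [:a, b, c:] z = a + b * gconst z + c * gconst (z\<^sup>2)"
  by (subst gpoly_eq_sum[where n = 2]) (auto simp: numeral_2_eq_2 atMost_Suc add_ac)

section \<open>Alternating functions of four indices and contraction of \<epsilon>\<close>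

text \<open>
  These instances only sort indices, so the simplifier terminates with them, unlike with
  \<open>levi_civita_antisym\<close> itself.
\<close>

lemmas levi_civita_sort =
  levi_civita_antisym(1)[where B = 2 and A = 1] levi_civita_antisym(1)[where B = 3 and A = 1]
  levi_civita_antisym(1)[where B = 4 and A = 1] levi_civita_antisym(1)[where B = 3 and A = 2]
  levi_civita_antisym(1)[where B = 4 and A = 2] levi_civita_antisym(1)[where B = 4 and A = 3]
  levi_civita_antisym(2)[where C = 2 and B = 1] levi_civita_antisym(2)[where C = 3 and B = 1]
  levi_civita_antisym(2)[where C = 4 and B = 1] levi_civita_antisym(2)[where C = 3 and B = 2]
  levi_civita_antisym(2)[where C = 4 and B = 2] levi_civita_antisym(2)[where C = 4 and B = 3]
  levi_civita_antisym(3)[where D = 2 and C = 1] levi_civita_antisym(3)[where D = 3 and C = 1]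
  levi_civita_antisym(3)[where D = 4 and C = 1] levi_civita_antisym(3)[where D = 3 and C = 2]
  levi_civita_antisym(3)[where D = 4 and C = 2] levi_civita_antisym(3)[where D = 4 and C = 3]

lemma levi_civita_repeat:
  "levi_civita A A C D = 0" "levi_civita A B B D = 0" "levi_civita A B C C = 0"
  using levi_civita_antisym(1)[of A A C D] levi_civita_antisym(2)[of A B B D]
    levi_civita_antisym(3)[of A B C C] by simp_all

text \<open>Adjacent swaps sort any index tuple to \<open>1 2 3 4\<close> or bring two equal indices
  together. The sign picked up is the same for \<open>f\<close> and for \<epsilon>.\<close>

lemma alternating_eq_levi_civita:
  fixes f :: "4 \<Rightarrow> 4 \<Rightarrow> 4 \<Rightarrow> 4 \<Rightarrow> 'g::{finite,linorder} grassmann"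
  assumes swap1: "\<And>A B C D. f B A C D = - f A B C D"
    and swap2: "\<And>A B C D. f A C B D = - f A B C D"
    and swap3: "\<And>A B C D. f A B D C = - f A B C D"
  shows "f A B C D = gconst (levi_civita A B C D) * f 1 2 3 4"
proof -
  have f_repeat: "f A A C D = 0" "f A B B D = 0" "f A B C C = 0" for A B C D
    using swap1[of A A C D] swap2[of A B B D] swap3[of A B C C]
    by (simp_all only: grassmann_eq_minus_self_iff)
  note f_sort =
    swap1[where B = 2 and A = 1] swap1[where B = 3 and A = 1] swap1[where B = 4 and A = 1]
    swap1[where B = 3 and A = 2] swap1[where B = 4 and A = 2] swap1[where B = 4 and A = 3]
    swap2[where C = 2 and B = 1] swap2[where C = 3 and B = 1] swap2[where C = 4 and B = 1]
    swap2[where C = 3 and B = 2] swap2[where C = 4 and B = 2] swap2[where C = 4 and B = 3]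
    swap3[where D = 2 and C = 1] swap3[where D = 3 and C = 1] swap3[where D = 4 and C = 1]
    swap3[where D = 3 and C = 2] swap3[where D = 4 and C = 2] swap3[where D = 4 and C = 3]
  have "\<forall>A B C D. f A B C D = gconst (levi_civita A B C D) * f 1 2 3 4"
    by (simp add: forall_4 f_repeat f_sort levi_civita_repeat levi_civita_sort levi_civita_1234
        gconst_minus)
  then show ?thesis by blast
qed

text \<open>For \<open>F = D\<close> each of the six orderings of the other three indices
  contributes a square of a sign; for \<open>F \<noteq> D\<close> no triple makes both symbols
  nonzero.\<close>

lemma levi_civita_contract:
  "(\<Sum>G\<in>UNIV. \<Sum>H\<in>UNIV. \<Sum>I\<in>UNIV. levi_civita F G H I * levi_civita D G H I) =
    (if F = D then 6 else 0)"
proof -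
  have "\<forall>F D. (\<Sum>G\<in>UNIV. \<Sum>H\<in>UNIV. \<Sum>I\<in>UNIV. levi_civita F G H I * levi_civita D G H I) =
    (if F = D then 6 else 0)"
    by (simp add: forall_4 sum_4 levi_civita_repeat levi_civita_sort levi_civita_1234)
  then show ?thesis by blast
qed

section \<open>The polarized cubic and its symmetries\<close>

definition cubic_polar ::
  "complex^4^4 \<Rightarrow> (4 \<Rightarrow> 'g::{finite,linorder} grassmann) \<Rightarrow> (4 \<Rightarrow> 'g grassmann) \<Rightarrow>
    (4 \<Rightarrow> 'g grassmann) \<Rightarrow> 4 \<Rightarrow> 'g grassmann" where
  "cubic_polar M \<xi> \<eta> \<zeta> A = (\<Sum>B\<in>UNIV. \<Sum>C\<in>UNIV. \<Sum>D\<in>UNIV. \<Sum>E\<in>UNIV.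
     gconst (M $ A $ B * levi_civita B C D E) * \<xi> C * \<eta> D * \<zeta> E)"

lemma cubic_eq_cubic_polar: "cubic M \<xi> A = cubic_polar M \<xi> \<xi> \<xi> A"
  by (simp add: cubic_def cubic_polar_def)

lemma cubic_polar_add:
  "cubic_polar M (\<lambda>A. \<xi> A + \<xi>' A) \<eta> \<zeta> A = cubic_polar M \<xi> \<eta> \<zeta> A + cubic_polar M \<xi>' \<eta> \<zeta> A"
  "cubic_polar M \<xi> (\<lambda>A. \<eta> A + \<eta>' A) \<zeta> A = cubic_polar M \<xi> \<eta> \<zeta> A + cubic_polar M \<xi> \<eta>' \<zeta> A"
  "cubic_polar M \<xi> \<eta> (\<lambda>A. \<zeta> A + \<zeta>' A) A = cubic_polar M \<xi> \<eta> \<zeta> A + cubic_polar M \<xi> \<eta> \<zeta>' A"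
  by (simp_all add: cubic_polar_def sum.distrib distrib_left distrib_right)

lemma cubic_polar_scale:
  "cubic_polar M (\<lambda>A. gconst c * \<xi> A) \<eta> \<zeta> A = gconst c * cubic_polar M \<xi> \<eta> \<zeta> A"
  "cubic_polar M \<xi> (\<lambda>A. gconst c * \<eta> A) \<zeta> A = gconst c * cubic_polar M \<xi> \<eta> \<zeta> A"
  "cubic_polar M \<xi> \<eta> (\<lambda>A. gconst c * \<zeta> A) A = gconst c * cubic_polar M \<xi> \<eta> \<zeta> A"
  unfolding cubic_polar_def sum_distrib_left
  by (intro sum.cong refl; simp add: mult.assoc gconst_left_commute[of _ c])+

lemma cubic_polar_uminus:
  "cubic_polar M (\<lambda>A. - \<xi> A) \<eta> \<zeta> A = - cubic_polar M \<xi> \<eta> \<zeta> A"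
  "cubic_polar M \<xi> (\<lambda>A. - \<eta> A) \<zeta> A = - cubic_polar M \<xi> \<eta> \<zeta> A"
  by (simp_all add: cubic_polar_def sum_negf)

text \<open>Renaming the summation indices \<open>C\<close> and \<open>D\<close> costs the sign of
  \<epsilon>. The new arguments \<open>\<xi>'\<close> and \<open>\<eta>'\<close> are kept general so
  that both the swap of anticommuting arguments and the vanishing on symmetric products are
  instances.\<close>

lemma cubic_polar_exchange_left:
  assumes "\<And>C D. \<xi> C * \<eta> D = \<xi>' D * \<eta>' C"
  shows "cubic_polar M \<xi> \<eta> \<zeta> A = - cubic_polar M \<xi>' \<eta>' \<zeta> A"
proof -
  have "gconst (M $ A $ B * levi_civita B D C E) * \<xi> D * \<eta> C * \<zeta> E =
    - (gconst (M $ A $ B * levi_civita B C D E) * \<xi>' C * \<eta>' D * \<zeta> E)" for B C D E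
    using assms[of D C]
    by (simp add: levi_civita_antisym(2)[of B D C E] gconst_minus mult.assoc
        flip: mult.assoc[of "\<xi> D"])
  moreover have "cubic_polar M \<xi> \<eta> \<zeta> A = (\<Sum>B\<in>UNIV. \<Sum>C\<in>UNIV. \<Sum>D\<in>UNIV. \<Sum>E\<in>UNIV.
     gconst (M $ A $ B * levi_civita B D C E) * \<xi> D * \<eta> C * \<zeta> E)"
    unfolding cubic_polar_def by (rule sum.cong[OF refl], rule sum.swap)
  ultimately show ?thesis
    by (simp add: cubic_polar_def sum_negf)
qed

lemma cubic_polar_exchange_right:
  assumes "\<And>C D. \<eta> C * \<zeta> D = \<eta>' D * \<zeta>' C"
  shows "cubic_polar M \<xi> \<eta> \<zeta> A = - cubic_polar M \<xi> \<eta>' \<zeta>' A"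
proof -
  have "gconst (M $ A $ B * levi_civita B C E D) * \<xi> C * \<eta> E * \<zeta> D =
    - (gconst (M $ A $ B * levi_civita B C D E) * \<xi> C * \<eta>' D * \<zeta>' E)" for B C D E
    using assms[of E D]
    by (simp add: levi_civita_antisym(3)[of B C E D] gconst_minus mult.assoc)
  moreover have "cubic_polar M \<xi> \<eta> \<zeta> A = (\<Sum>B\<in>UNIV. \<Sum>C\<in>UNIV. \<Sum>D\<in>UNIV. \<Sum>E\<in>UNIV.
     gconst (M $ A $ B * levi_civita B C E D) * \<xi> C * \<eta> E * \<zeta> D)"
    unfolding cubic_polar_def
    by (rule sum.cong[OF refl], rule sum.cong[OF refl], rule sum.swap)
  ultimately show ?thesis
    by (simp add: cubic_polar_def sum_negf)
qed

text \<open>The sign of anticommutation, absorbed into the argument \<open>- \<eta> A\<close>,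
  cancels the sign of \<epsilon>.\<close>

lemma cubic_polar_swap_left:
  assumes "\<And>C D. \<xi> C * \<eta> D = - (\<eta> D * \<xi> C)"
  shows "cubic_polar M \<xi> \<eta> \<zeta> A = cubic_polar M \<eta> \<xi> \<zeta> A"
  using cubic_polar_exchange_left[of \<xi> \<eta> "\<lambda>A. - \<eta> A" \<xi> M \<zeta> A] assms
  by (simp add: cubic_polar_uminus)

lemma cubic_polar_swap_right:
  assumes "\<And>C D. \<eta> C * \<zeta> D = - (\<zeta> D * \<eta> C)"
  shows "cubic_polar M \<xi> \<eta> \<zeta> A = cubic_polar M \<xi> \<zeta> \<eta> A"
  using cubic_polar_exchange_right[of \<eta> \<zeta> "\<lambda>A. - \<zeta> A" \<eta> M \<xi> A] assms
  by (simp add: cubic_polar_uminus)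

text \<open>A product symmetric in \<open>C\<close> and \<open>D\<close> is contracted with
  \<epsilon>, so the form equals its own negative.\<close>

lemma cubic_polar_eq_0_left:
  assumes "\<And>C D. \<xi> C * \<eta> D = \<xi> D * \<eta> C"
  shows "cubic_polar M \<xi> \<eta> \<zeta> A = 0"
  using cubic_polar_exchange_left[of \<xi> \<eta> \<xi> \<eta>, OF assms] grassmann_eq_minus_self_iff by blast

lemma cubic_polar_eq_0_right:
  assumes "\<And>C D. \<eta> C * \<zeta> D = \<eta> D * \<zeta> C"
  shows "cubic_polar M \<xi> \<eta> \<zeta> A = 0"
  using cubic_polar_exchange_right[of \<eta> \<zeta> \<eta> \<zeta>, OF assms] grassmann_eq_minus_self_iff by blast

section \<open>Products of odd elements with their cubic\<close>

text \<open>Passing three odd factors gives the sign \<open>(-1) ^ 3\<close>.\<close>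

lemma odd_mult_cubic:
  assumes "\<And>C. x * \<theta> C = - (\<theta> C * x)"
  shows "x * cubic_polar M \<theta> \<theta> \<theta> A = - (cubic_polar M \<theta> \<theta> \<theta> A * x)"
proof -
  have odd: "x * (\<theta> C * y) = - (\<theta> C * (x * y))" for C y
    using assms by (metis mult.assoc mult_minus_left)
  show ?thesis
    unfolding cubic_polar_def sum_distrib_left sum_distrib_right sum_negf[symmetric]
    by (intro sum.cong refl) (simp add: mult.assoc gconst_left_commute[of x] assms odd)
qed

context
  fixes \<theta> :: "4 \<Rightarrow> 'g::{finite,linorder} grassmann"
  assumes anticommute: "\<And>C D. \<theta> C * \<theta> D = - (\<theta> D * \<theta> C)"
begin

text \<open>The product of four \<theta>'s is alternating, hence \<epsilon> times the top product;
  contracting the two \<epsilon>'s leaves 6 times a Kronecker delta.\<close>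

lemma anticommuting_mult_cubic:
  "\<theta> D * cubic_polar M \<theta> \<theta> \<theta> A = gconst (6 * M $ A $ D) * (\<theta> 1 * \<theta> 2 * \<theta> 3 * \<theta> 4)"
proof -
  have alternating: "\<theta> D * \<theta> C * \<theta> E * \<theta> F =
      gconst (levi_civita D C E F) * (\<theta> 1 * \<theta> 2 * \<theta> 3 * \<theta> 4)" for D C E F
  proof (rule alternating_eq_levi_civita)
    fix A B C D
    show "\<theta> B * \<theta> A * \<theta> C * \<theta> D = - (\<theta> A * \<theta> B * \<theta> C * \<theta> D)"
      by (subst anticommute) simp
    show "\<theta> A * \<theta> C * \<theta> B * \<theta> D = - (\<theta> A * \<theta> B * \<theta> C * \<theta> D)"
      using anticommute[of C B] by (simp add: mult.assoc flip: mult.assoc[of "\<theta> C" "\<theta> B"])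
    show "\<theta> A * \<theta> B * \<theta> D * \<theta> C = - (\<theta> A * \<theta> B * \<theta> C * \<theta> D)"
      using anticommute[of D C] by (simp add: mult.assoc)
  qed
  have "\<theta> D * (gconst (M $ A $ B * levi_civita B C E F) * \<theta> C * \<theta> E * \<theta> F) =
      gconst (M $ A $ B * (levi_civita B C E F * levi_civita D C E F)) *
        (\<theta> 1 * \<theta> 2 * \<theta> 3 * \<theta> 4)" for B C E F
  proof -
    have "\<theta> D * (gconst (M $ A $ B * levi_civita B C E F) * \<theta> C * \<theta> E * \<theta> F) =
        gconst (M $ A $ B * levi_civita B C E F) * (\<theta> D * \<theta> C * \<theta> E * \<theta> F)"
      by (simp add: mult.assoc gconst_left_commute[of "\<theta> D"])
    then show ?thesis
      by (simp only: alternating[of D C E F]) (simp add: gconst_mult mult.assoc)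
  qed
  then have "\<theta> D * cubic_polar M \<theta> \<theta> \<theta> A =
      gconst (\<Sum>B\<in>UNIV. M $ A $ B * (\<Sum>C\<in>UNIV. \<Sum>E\<in>UNIV. \<Sum>F\<in>UNIV.
        levi_civita B C E F * levi_civita D C E F)) * (\<theta> 1 * \<theta> 2 * \<theta> 3 * \<theta> 4)"
    by (simp only: cubic_polar_def sum_distrib_left gconst_sum sum_distrib_right)
  then show ?thesis
    by (simp add: levi_civita_contract if_distrib mult.commute cong: if_cong)
qed

text \<open>The top product already contains \<open>\<theta> D\<close>, whose square is
  zero.\<close>

lemma anticommuting_mult_top: "\<theta> D * (\<theta> 1 * \<theta> 2 * \<theta> 3 * \<theta> 4) = 0"
proof -
  have square: "\<theta> C * \<theta> C = 0" for C
    using anticommute[of C C] grassmann_eq_minus_self_iff by blast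
  have square': "\<theta> C * (\<theta> C * y) = 0" for C y
    by (metis square mult.assoc mult_zero_left)
  have anticommute': "\<theta> C * (\<theta> D * y) = - (\<theta> D * (\<theta> C * y))" for C D y
    by (metis anticommute mult.assoc mult_minus_left)
  have "\<forall>D. \<theta> D * (\<theta> 1 * \<theta> 2 * \<theta> 3 * \<theta> 4) = 0"
    by (simp add: forall_4 mult.assoc square square' anticommute'[of 2 1] anticommute'[of 3 1]
        anticommute'[of 3 2] anticommute'[of 4 1] anticommute'[of 4 2] anticommute'[of 4 3])
  then show ?thesis by blast
qed

lemma anticommuting_cubic_mult_cubic:
  "cubic_polar M \<theta> \<theta> \<theta> A * cubic_polar M \<theta> \<theta> \<theta> B = 0"
proof -
  \<comment> \<open>Expanding only the left cubic suffices: its last factor turns the right one into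
    a multiple of the top product, which the factor before it kills.\<close>
  have "\<theta> C * (\<theta> D * cubic_polar M \<theta> \<theta> \<theta> B) = 0" for C D
    by (simp add: anticommuting_mult_cubic gconst_left_commute[of "\<theta> C"]
        anticommuting_mult_top)
  then show ?thesis
    by (subst (1) cubic_polar_def) (simp add: sum_distrib_right mult.assoc)
qed

end

section \<open>Expansion of the cubic along the curve\<close>

lemma cubic_polar_curve:
  fixes a b :: "4 \<Rightarrow> 'g::{finite,linorder} grassmann" and p q r :: complex
  assumes symmetric: "\<And>A B. M $ A $ B = M $ B $ A"
    and aa: "\<And>C D. a C * a D = - (a D * a C)"
    and ab: "\<And>C D. a C * b D = - (b D * a C)"
    and bb: "\<And>C D. b C * b D = - (b D * b C)"
  defines "k \<equiv> cubic_polar M b b b"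
  defines "\<psi> \<equiv> \<lambda>A. gconst p * a A + gconst q * b A + gconst r * k A"
  shows "cubic_polar M \<psi> \<psi> \<psi> A =
    gconst (p ^ 3) * cubic_polar M a a a A + gconst (3 * p\<^sup>2 * q) * cubic_polar M a a b A +
    gconst (3 * p * q\<^sup>2) * cubic_polar M a b b A + gconst (q ^ 3) * k A +
    gconst (3 * p\<^sup>2 * r) * cubic_polar M a a k A"
proof -
  have ak: "a C * k D = - (k D * a C)" for C D
    unfolding k_def by (rule odd_mult_cubic) (rule ab)
  have bk: "b C * k D = - (k D * b C)" for C D
    unfolding k_def by (rule odd_mult_cubic) (rule bb)
  have kk: "k C * k D = 0" for C D
    unfolding k_def by (rule anticommuting_cubic_mult_cubic) (rule bb)
  \<comment> \<open>Both sides are multiples of the same top product, with factors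
    \<open>6 * M $ D $ C\<close> and \<open>6 * M $ C $ D\<close>; this is where the symmetry of
    \<open>M\<close> enters.\<close>
  have bk_sym: "b C * k D = b D * k C" for C D
    unfolding k_def anticommuting_mult_cubic[of b, OF bb] symmetric[of D C] ..
  have kb_sym: "k C * b D = k D * b C" for C D
    using bk[of D C] bk[of C D] bk_sym[of C D] by simp
  have vanish: "cubic_polar M b k \<zeta> A = 0" "cubic_polar M k b \<zeta> A = 0"
    "cubic_polar M \<zeta> b k A = 0" "cubic_polar M \<zeta> k b A = 0"
    "cubic_polar M k k \<zeta> A = 0" "cubic_polar M \<zeta> k k A = 0" for \<zeta>
    by (rule cubic_polar_eq_0_left cubic_polar_eq_0_right; simp add: kk bk_sym kb_sym)+
  \<comment> \<open>Moving every \<open>a\<close> to the front puts the remaining \<open>b\<close>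
    and \<open>k\<close> in adjacent slots, where \<open>vanish\<close> applies; of the terms with
    \<open>k\<close> as an argument only those with two \<open>a\<close> survive.\<close>
  have ka: "cubic_polar M k a \<zeta> A = cubic_polar M a k \<zeta> A"
    "cubic_polar M \<zeta> k a A = cubic_polar M \<zeta> a k A" for \<zeta>
    by (simp_all add: cubic_polar_swap_left[of a k, OF ak] cubic_polar_swap_right[of a k, OF ak])
  have ba: "cubic_polar M b a \<zeta> A = cubic_polar M a b \<zeta> A"
    "cubic_polar M \<zeta> b a A = cubic_polar M \<zeta> a b A" for \<zeta>
    by (simp_all add: cubic_polar_swap_left[of a b, OF ab] cubic_polar_swap_right[of a b, OF ab])
  have kA: "cubic_polar M b b b A = k A"
    by (simp add: k_def)
  show ?thesis
    \<comment> \<open>Coefficientwise the scalars become complex factors, so commutative arithmetic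
      collects the 27 terms.\<close>
    unfolding gcoeff_inject[symmetric] \<psi>_def
    by (rule ext)
      (simp add: cubic_polar_add cubic_polar_scale vanish ka ba kA
        gcoeff_add gcoeff_gconst_mult algebra_simps power2_eq_square power3_eq_cube)
qed

section \<open>The coordinates on the second patch as polynomials in Z'\<close>

lemma theta_anticommute: "theta \<alpha> A * theta \<beta> B = - (theta \<beta> B * theta \<alpha> A)"
  unfolding theta_def by (rule generator_anticommute)

lemma Z_coord_curve: "Z_coord (curve M x Z) = Z"
  by (simp add: curve_def)

theorem mainTheorem1:
  fixes M :: "complex^4^4" and x :: "complex^2^2"
  assumes symmetric: "\<And>A B. M $ A $ B = M $ B $ A"
  shows "\<exists>(PX :: Lambda poly) (PY :: Lambda poly) (PPsi :: 4 \<Rightarrow> Lambda poly).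
    \<forall>Z :: complex. Z \<noteq> 0 \<longrightarrow>
      (let Z' = 1 / Z in
        transition M (curve M x Z) =
          \<lparr> X_coord = gpoly PX Z',
            Y_coord = gpoly PY Z',
            Z_coord = Z',
            Psi_coord = (\<lambda>A. gpoly (PPsi A) Z') \<rparr>)"
proof -
  let ?a = "theta 1" and ?b = "theta 2"
  let ?T = "cubic_polar M"
  let ?k = "?T ?b ?b ?b"
  \<comment> \<open>Division by Z interchanges the constant and linear coefficients. The dotted
    index \<open>\<beta>\<close> gives X' for 1 and Y' for 2.\<close>
  define PX where "PX = (\<lambda>\<beta>. [:gconst (- x $ 2 $ \<beta>), gconst (- x $ 1 $ \<beta>):] :: Lambda poly)"
  \<comment> \<open>The coefficients are read off from \<open>cubic_polar_curve\<close> with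
    \<open>p = -1\<close>, \<open>q = -Z\<close>, \<open>r = Z\<^sup>2 / 6\<close>, divided by
    \<open>6 * Z\<^sup>2\<close>, plus the curve divided by Z. For instance 1/12 is 3 * (1/6) *
    (1/6).\<close>
  define PPsi where "PPsi = (\<lambda>A.
    [:- ?b A - gconst (1 / 2) * ?T ?a ?b ?b A + gconst (1 / 12) * ?T ?a ?a ?k A,
      - ?a A - gconst (1 / 2) * ?T ?a ?a ?b A,
      - gconst (1 / 6) * ?T ?a ?a ?a A:])"
  have main: "transition M (curve M x Z) =
      \<lparr> X_coord = gpoly (PX 1) (1 / Z), Y_coord = gpoly (PX 2) (1 / Z), Z_coord = 1 / Z,
        Psi_coord = (\<lambda>A. gpoly (PPsi A) (1 / Z)) \<rparr>" if Z: "Z \<noteq> 0" for Z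
  proof -
    have X: "gconst (1 / Z) * gconst (- x $ 1 $ \<beta> - x $ 2 $ \<beta> * Z) = gpoly (PX \<beta>) (1 / Z)" for \<beta>
      unfolding PX_def gpoly_linear gconst_mult[symmetric] gconst_add[symmetric]
      using Z by (auto intro!: arg_cong[where f = gconst] simp: diff_divide_distrib)
    define \<psi> where "\<psi> = Psi_coord (curve M x Z)"
    have \<psi>: "\<psi> = (\<lambda>A. gconst (- 1) * ?a A + gconst (- Z) * ?b A + gconst (Z\<^sup>2 / 6) * ?k A)"
      unfolding \<psi>_def gcoeff_inject[symmetric] fun_eq_iff
      by (simp add: curve_def cubic_eq_cubic_polar gcoeff_add gcoeff_diff gcoeff_minus
          gcoeff_gconst_mult gcoeff_mult_gconst gconst_minus)
    have cubic_\<psi>: "cubic M \<psi> A =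
        gconst ((- 1) ^ 3) * ?T ?a ?a ?a A + gconst (3 * (- 1)\<^sup>2 * (- Z)) * ?T ?a ?a ?b A +
        gconst (3 * (- 1) * (- Z)\<^sup>2) * ?T ?a ?b ?b A + gconst ((- Z) ^ 3) * ?k A +
        gconst (3 * (- 1)\<^sup>2 * (Z\<^sup>2 / 6)) * ?T ?a ?a ?k A" for A
      unfolding \<psi> cubic_eq_cubic_polar
      by (rule cubic_polar_curve[where a = ?a and b = ?b and p = "- 1" and q = "- Z" and
            r = "Z\<^sup>2 / 6", OF symmetric]) (rule theta_anticommute)+
    have Psi: "gconst (1 / Z) * \<psi> A + gconst (1 / (6 * Z\<^sup>2)) * cubic M \<psi> A =
        gpoly (PPsi A) (1 / Z)" for A
    proof -
      \<comment> \<open>As an identity of complex coefficients this is rational arithmetic in Z, in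
        which the two terms \<open>?k A\<close> times Z/6 cancel.\<close>
      have "gcoeff (gconst (1 / Z) * \<psi> A + gconst (1 / (6 * Z\<^sup>2)) * cubic M \<psi> A) U =
          gcoeff (gpoly (PPsi A) (1 / Z)) U" for U
        unfolding cubic_\<psi> PPsi_def gpoly_quadratic
        unfolding \<psi> gcoeff_add gcoeff_diff gcoeff_gconst_mult gcoeff_mult_gconst
        using Z by (simp add: gcoeff_minus gcoeff_gconst_mult field_simps
            power2_eq_square power3_eq_cube)
      then show ?thesis
        unfolding gcoeff_inject[symmetric] by blast
    qed
    show ?thesis
      unfolding transition_def Let_def \<psi>_def[symmetric]
      by (simp only: Z_coord_curve Psi) (simp only: curve_def coordinates.select_convs X)
  qed
  show ?thesis
    unfolding Let_def by (intro exI allI impI) (rule main)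
qed

end
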